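(* Let $\mathbb{A}$ be a finite alphabet with $|\mathbb{A}|\ge 2$, and let $\log$ denote the logarithm to base $|\mathbb{A}|$. For each integer $n\ge 1$ there exists a word of length $n$ over $\mathbb{A}$ with at least \[\frac{n^2}{6}-\frac{2n}{3}\left\lceil\log\frac{n}{3}\right\rceil-\frac{5n}{6}\] distinct closed factors.
   Context: A factor of a word is a contiguous subword (possibly empty). A border of a finite word $v$ is a proper prefix of $v$ which is also a suffix of $v$. A finite word $v$ is closed if $|v|\le 1$ (so the empty word and the letters are closed), or if $|v|\ge 2$ and the longest border of $v$ is non-empty and occurs in $v$ exactly twice (as a prefix and as a suffix). *)

theory Defs
  imports Complex_Main "HOL-Library.Sublist"
begin

definition border :: "'a list \<Rightarrow> 'a list \<Rightarrow> bool" where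
  "border b v \<longleftrightarrow> strict_prefix b v \<and> suffix b v"

definition longest_border :: "'a list \<Rightarrow> 'a list \<Rightarrow> bool" where
  "longest_border b v \<longleftrightarrow> border b v \<and> (\<forall>b'. border b' v \<longrightarrow> length b' \<le> length b)"

(* Starting positions; occurrences may overlap. *)
definition occurrences :: "'a list \<Rightarrow> 'a list \<Rightarrow> nat set" where
  "occurrences u v = {i. i + length u \<le> length v \<and> take (length u) (drop i v) = u}"

(* A border is already a prefix and a suffix, and being shorter than the word it
   starts at two different positions there, so exactly two occurrences means no others. *)
definition closed_word :: "'a list \<Rightarrow> bool" where
  "closed_word v \<longleftrightarrow> length v \<le> 1 \<or>
     (\<exists>b. longest_border b v \<and> b \<noteq> [] \<and> card (occurrences b v) = 2)"

(* Factors are contiguous: this is the meaning of sublist (as opposed to subseq). *)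
definition closed_factors :: "'a list \<Rightarrow> 'a list set" where
  "closed_factors w = {u. sublist u w \<and> closed_word u}"

lemma finite_closed_factors: "finite (closed_factors w)"
proof (rule finite_subset)
  show "closed_factors w \<subseteq> {u. set u \<subseteq> set w \<and> length u \<le> length w}"
    by (auto simp: closed_factors_def dest: set_mono_sublist sublist_length_le)
  show "finite {u. set u \<subseteq> set w \<and> length u \<le> length w}"
    by (rule finite_lists_length_le) simp
qed

end

theory Submission
  imports Defs "HOL-Library.FuncSet" "HOL-Number_Theory.Cong"
begin

text \<open>
  Let \<open>g\<close> be a sequence of period \<open>p\<close> in which equal blocks of length \<open>M\<close> start at positions
  congruent modulo \<open>p\<close>.  A factor of \<open>g\<close> of length \<open>p + m\<close> with \<open>m \<ge> M\<close> has a border of length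
  \<open>m\<close>, and the block condition forces this border to be the longest one and to occur nowhere else;
  so every such factor is closed.  With \<open>p = n div 3\<close> the prefix of length \<open>n\<close> has enough of them,
  provided \<open>M\<close> is at most \<open>2 L + 4\<close>, where \<open>L = \<lceil>log (n / 3)\<rceil>\<close>.  Such a \<open>g\<close> exists by a first-moment
  count: for given starts \<open>i\<close> and \<open>i + d\<close>, the sequences having equal blocks there form at most a
  fraction \<open>card A ^ (-M)\<close> of all sequences of period \<open>p\<close>, and there are about \<open>p\<^sup>2 / 2\<close> pairs \<open>(i, d)\<close>.
  The count needs \<open>M\<close> to be at most about \<open>p / 2\<close>; periods up to \<open>2 L + 4\<close> are instead served by
  \<open>x y y \<dots> y\<close> with \<open>M = p\<close>.
\<close>

definition distinct_blocks :: "(nat \<Rightarrow> 'a) \<Rightarrow> nat \<Rightarrow> nat \<Rightarrow> bool" where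
  "distinct_blocks g p M \<longleftrightarrow>
     (\<forall>i j. (\<forall>t<M. g (i + t) = g (j + t)) \<longrightarrow> i mod p = j mod p)"

lemma distinct_blocksD:
  assumes "distinct_blocks g p M" "M \<le> m" "\<And>t. t < m \<Longrightarrow> g (i + t) = g (j + t)"
  shows "i mod p = j mod p"
  using assms unfolding distinct_blocks_def by (meson less_le_trans)

subsection \<open>Closed factors of a periodic sequence\<close>

lemma map_upt_eq_iff:
  "map g [i..<i + l] = map g [j..<j + l] \<longleftrightarrow> (\<forall>t<l. g (i + t) = g (j + t))"
  by (auto simp: list_eq_iff_nth_eq)

lemma occurrences_map_upt:
  "occurrences (map g [j..<j + m]) (map g [i..<i + l]) =
     {q. q + m \<le> l \<and> (\<forall>t<m. g (i + q + t) = g (j + t))}"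
  by (auto simp: occurrences_def list_eq_iff_nth_eq add.assoc)

text \<open>Overlaying the prefix copy and the suffix copy of a border shows \<open>g\<close>
  agreeing with its shift by \<open>l - length b\<close>, the form to which
  \<open>distinct_blocks\<close> applies.\<close>

lemma border_map_upt:
  assumes "border b (map g [i..<i + l])"
  shows "length b < l" "t < length b \<Longrightarrow> g (i + (l - length b) + t) = g (i + t)"
proof -
  let ?v = "map g [i..<i + l]"
  obtain c where c: "?v = b @ c" "c \<noteq> []"
    using assms by (auto simp: border_def strict_prefix_def prefix_def)
  obtain d where d: "?v = d @ b"
    using assms by (auto simp: border_def suffix_def)
  have lc: "length b + length c = l" and ld: "length d + length b = l"
    using arg_cong[OF c(1), of length] arg_cong[OF d, of length] by simp_all
  show "length b < l" using lc c(2) by (cases c) auto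
  assume t: "t < length b"
  have "?v ! t = b ! t" using t by (subst c(1)) (simp add: nth_append)
  moreover have "?v ! (length d + t) = b ! t" by (subst d) simp
  ultimately show "g (i + (l - length b) + t) = g (i + t)"
    using t lc ld by (auto simp: add.assoc)
qed

lemma closed_word_periodic:
  assumes per: "\<And>i. g (i + p) = g i"
    and db: "distinct_blocks g p M"
    and "p \<ge> 1" "M \<ge> 1" "m \<ge> M"
  shows "closed_word (map g [i..<i + (p + m)])"
proof -
  let ?v = "map g [i..<i + (p + m)]" and ?b = "map g [i..<i + m]"
  have "[i..<i + (p + m)] = [i..<i + m] @ [i + m..<i + (p + m)]"
    using upt_add_eq_append[of i "i + m" p] by (simp add: ac_simps)
  then have "prefix ?b ?v" by (metis map_append prefixI)
  then have "strict_prefix ?b ?v"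
    using \<open>p \<ge> 1\<close> by (auto simp: strict_prefix_def dest: arg_cong[of _ _ length])
  moreover have "?v = map g [i..<i + p] @ ?b"
  proof -
    have "[i..<i + (p + m)] = [i..<i + p] @ [i + p..<i + p + m]"
      using upt_add_eq_append[of i "i + p" m] by (simp add: ac_simps)
    moreover have "map g [i + p..<i + p + m] = ?b"
      using per by (subst map_upt_eq_iff) (metis add.assoc add.commute)
    ultimately show ?thesis by simp
  qed
  then have "suffix ?b ?v" by (metis suffixI)
  ultimately have border: "border ?b ?v" by (simp add: border_def)
  have longest: "length b \<le> length ?b" if "border b ?v" for b
  proof (rule ccontr)
    assume "\<not> length b \<le> length ?b"
    then have len: "m < length b" by simp
    \<comment> \<open>The shift of a supposed longer border: properness makes it positive, and a
      length above \<open>m\<close> makes it less than \<open>p\<close>, so it cannot be a multiple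
      of \<open>p\<close>.\<close>
    define q where "q = p + m - length b"
    have q: "0 < q" "q < p"
      using border_map_upt(1)[OF that] len \<open>m \<ge> M\<close> by (auto simp: q_def)
    have "(i + q) mod p = (i + 0) mod p"
      using distinct_blocksD[OF db, of "length b" "i + q" "i + 0"]
        border_map_upt(2)[OF that] len \<open>m \<ge> M\<close> by (simp add: q_def)
    with q show False
      by (metis add_diff_cancel_left' mod_eq_dvd_iff_nat le_add1 add_0_right nat_dvd_not_less)
  qed
  have "occurrences ?b ?v = {0, p}"
  proof (intro equalityI subsetI)
    fix q assume "q \<in> occurrences ?b ?v"
    then have q: "q \<le> p" "\<forall>t<m. g (i + q + t) = g (i + t)"
      by (auto simp: occurrences_map_upt)
    \<comment> \<open>An occurrence repeats a block of length at least \<open>M\<close>, so its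
      offset is a multiple of \<open>p\<close>; fitting into the word bounds it by
      \<open>p\<close>.\<close>
    have "(i + q) mod p = (i + 0) mod p"
      using distinct_blocksD[OF db \<open>m \<ge> M\<close>, of "i + q" "i + 0"] q(2) by simp
    then have "p dvd q"
      by (metis add_diff_cancel_left' mod_eq_dvd_iff_nat le_add1 add_0_right)
    with q(1) show "q \<in> {0, p}" by (auto dest: dvd_imp_le)
  next
    fix q assume "q \<in> {0, p}"
    then show "q \<in> occurrences ?b ?v"
      using per by (auto simp: occurrences_map_upt) (metis add.assoc add.commute)
  qed
  then have "card (occurrences ?b ?v) = 2" using \<open>p \<ge> 1\<close> by simp
  moreover have "?b \<noteq> []" using assms by simp
  ultimately show ?thesis
    using border longest unfolding closed_word_def longest_border_def by blast
qed

section \<open>Counting the closed factors of a prefix\<close>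

lemma sublist_map_upt:
  assumes "i + l \<le> n"
  shows "sublist (map g [i..<i + l]) (map g [0..<n])"
proof -
  have "[0..<n] = [0..<i] @ [i..<i + l] @ [i + l..<n]"
    using assms upt_add_eq_append[of 0 i "n - i"] upt_add_eq_append[of i "i + l" "n - (i + l)"]
    by simp
  then show ?thesis by (metis map_append sublist_appendI)
qed

text \<open>A length \<open>l\<close> leaves \<open>n + 1 - l\<close> starting positions. Those
  below \<open>p\<close> give pairwise different words, since equal words would repeat a block of
  length at least \<open>M\<close> at incongruent starts.\<close>

lemma card_closed_factors_periodic:
  assumes per: "\<And>i. g (i + p) = g i"
    and db: "distinct_blocks g p M"
    and "p \<ge> 1" "M \<ge> 1"
  shows "(\<Sum>l\<in>{p + M..n}. min p (n + 1 - l)) \<le> card (closed_factors (map g [0..<n]))"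
proof -
  let ?S = "SIGMA l : {p + M..n}. {..<min p (n + 1 - l)}"
  let ?h = "\<lambda>(l, i). map g [i..<i + l]"
  have "inj_on ?h ?S"
  proof (rule inj_onI, clarsimp)
    fix l i l' i'
    assume *: "p + M \<le> l" "i < p" "i' < p" "map g [i..<i + l] = map g [i'..<i' + l']"
    have "length (map g [i..<i + l]) = length (map g [i'..<i' + l'])"
      by (simp only: *(4))
    then have "l = l'" by simp
    moreover from this have "i mod p = i' mod p"
      using distinct_blocksD[OF db, of l i i'] * by (simp add: map_upt_eq_iff)
    ultimately show "l = l' \<and> i = i'" using * by simp
  qed
  moreover have "?h ` ?S \<subseteq> closed_factors (map g [0..<n])"
  proof (clarsimp simp: closed_factors_def)
    fix l i assume *: "p + M \<le> l" "l \<le> n" "i < p" "i < Suc n - l"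
    have "closed_word (map g [i..<i + (p + (l - p))])"
      by (rule closed_word_periodic[OF per db]) (use assms * in auto)
    moreover have "sublist (map g [i..<i + l]) (map g [0..<n])"
      by (rule sublist_map_upt) (use * in auto)
    ultimately show "sublist (map g [i..<i + l]) (map g [0..<n]) \<and> closed_word (map g [i..<i + l])"
      using * by simp
  qed
  ultimately have "card ?S \<le> card (closed_factors (map g [0..<n]))"
    by (intro card_inj_on_le finite_closed_factors)
  then show ?thesis by simp
qed

text \<open>The right side is the exact value for \<open>S >= p\<close>, where the terms grow from
  \<open>1\<close> to \<open>p\<close> and then stay constant; for smaller \<open>S\<close> it is
  only a lower bound.\<close>

lemma sum_min_ge:
  "2 * (\<Sum>s=1..S. real (min p s)) \<ge> 2 * real S * real p - real p * (real p - 1)"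
proof (cases "S \<le> p")
  case True
  then have "(\<Sum>s=1..S. real (min p s)) = (\<Sum>s=1..S. real s)" by (intro sum.cong) auto
  also have "2 * \<dots> = real S * (real S + 1)"
    by (induction S) (auto simp: algebra_simps)
  finally have eq: "2 * (\<Sum>s=1..S. real (min p s)) = real S * (real S + 1)" .
  obtain d where "p = S + d" using True le_Suc_ex by blast
  \<comment> \<open>The two sides differ by \<open>d * (d - 1)\<close>, which is nonnegative because
    \<open>d\<close> is a natural number.\<close>
  moreover have "real d \<le> real d * real d" by (cases d) auto
  ultimately show ?thesis unfolding eq by (simp add: algebra_simps)
next
  case False
  have "p \<le> S \<Longrightarrow> 2 * (\<Sum>s=1..S. real (min p s)) = 2 * real S * real p - real p * (real p - 1)"
  proof (induction S rule: dec_induct)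
    case base
    have "(\<Sum>s=1..p. real (min p s)) = (\<Sum>s=1..p. real s)" by (intro sum.cong) auto
    also have "2 * \<dots> = real p * (real p + 1)"
      by (induction p) (auto simp: algebra_simps)
    finally show ?case by (simp add: algebra_simps)
  qed (auto simp: algebra_simps)
  then show ?thesis using False by simp
qed

lemma sum_min_interval_ge:
  assumes "p \<le> n"
  shows "2 * real (\<Sum>l\<in>{p + M..n}. min p (n + 1 - l))
    \<ge> real p * (2 * (real n + 1 - real M) - 3 * real p + 1)"
proof (cases "p + M \<le> n")
  case True
  let ?S = "n + 1 - (p + M)"
  have "(\<Sum>l\<in>{p + M..n}. real (min p (n + 1 - l))) = (\<Sum>s=1..?S. real (min p s))"
    by (rule sum.reindex_bij_witness[of _ "\<lambda>s. n + 1 - s" "\<lambda>l. n + 1 - l"]) (use True in auto)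
  then show ?thesis
    using sum_min_ge[of ?S p] True by (simp add: of_nat_diff algebra_simps)
next
  case False
  \<comment> \<open>No length is available, so the sum is \<open>0\<close>; the claimed bound is
    then at most \<open>p * (1 - p)\<close>, which is not positive.\<close>
  then have "2 * (real n + 1 - real M) - 3 * real p + 1 \<le> 1 - real p" by simp
  then have "real p * (2 * (real n + 1 - real M) - 3 * real p + 1) \<le> real p * (1 - real p)"
    by (intro mult_left_mono) auto
  also have "\<dots> \<le> 0" by (cases p) (auto simp: mult_nonneg_nonpos)
  finally show ?thesis using False by simp
qed

subsection \<open>Cyclic words with distinct blocks\<close>

text \<open>As \<open>M + d \<le> p\<close>, a letter at offset \<open>s < M\<close> from \<open>i\<close> is a copy of the letter at the larger
  offset \<open>s + d < p\<close>, so the \<open>p - M\<close> letters at offsets \<open>M, \<dots>, p - 1\<close> determine the word.\<close>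

lemma card_repeated_block:
  fixes p :: nat
  assumes "finite A" "0 < d" "M + d \<le> p"
  shows "card {f \<in> {..<p} \<rightarrow>\<^sub>E A. \<forall>t<M. f ((i + t) mod p) = f ((i + d + t) mod p)}
    \<le> card A ^ (p - M)"
proof (cases "card A = 0")
  case True
  then have "A = {}" using assms(1) by simp
  moreover have "{..<p} \<noteq> {}" using assms by (auto simp: lessThan_empty_iff)
  ultimately have "{..<p} \<rightarrow>\<^sub>E A = {}" by (auto simp: PiE_eq_empty_iff)
  then show ?thesis by simp
next
  case False
  let ?B = "{f \<in> {..<p} \<rightarrow>\<^sub>E A. \<forall>t<M. f ((i + t) mod p) = f ((i + d + t) mod p)}"
  define D where "D = (\<lambda>s. (i + s) mod p) ` {M..<p}"
  have "p > 0" using assms by simp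
  have D: "finite D" "card D \<le> p - M" "D \<subseteq> {..<p}"
    using card_image_le[of "{M..<p}" "\<lambda>s. (i + s) mod p"] \<open>p > 0\<close> by (auto simp: D_def)
  have "inj_on (\<lambda>f. restrict f D) ?B"
  proof (rule inj_onI)
    fix f h assume f: "f \<in> ?B" and h: "h \<in> ?B" and eq: "restrict f D = restrict h D"
    have agree: "f ((i + s) mod p) = h ((i + s) mod p)" if "s < p" for s
      using that
    proof (induction "p - s" arbitrary: s rule: less_induct)
      case less
      show ?case
      proof (cases "s < M")
        case True
        have "f ((i + (s + d)) mod p) = h ((i + (s + d)) mod p)"
          by (rule less.hyps) (use True assms less.prems in auto)
        moreover have "f ((i + s) mod p) = f ((i + d + s) mod p)"
          "h ((i + s) mod p) = h ((i + d + s) mod p)"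
          using f h True by blast+
        ultimately show ?thesis by (simp add: ac_simps)
      next
        case False
        then have "(i + s) mod p \<in> D" using less.prems by (auto simp: D_def)
        then show ?thesis using eq by (metis restrict_apply')
      qed
    qed
    show "f = h"
    proof (rule PiE_ext)
      show "f \<in> {..<p} \<rightarrow>\<^sub>E A" "h \<in> {..<p} \<rightarrow>\<^sub>E A" using f h by auto
      fix x assume "x \<in> {..<p}"
      \<comment> \<open>The cyclic offset of \<open>x\<close> from \<open>i\<close>.\<close>
      define s where "s = (x + (p - i mod p)) mod p"
      have "(i + s) mod p = (i mod p + (x + (p - i mod p))) mod p"
        by (simp add: s_def mod_simps)
      also have "i mod p + (x + (p - i mod p)) = x + p"
        using mod_less_divisor[OF \<open>p > 0\<close>, of i] by linarith
      finally have "(i + s) mod p = x" using \<open>x \<in> {..<p}\<close> by simp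
      then show "f x = h x" using agree[of s] \<open>p > 0\<close> by (simp add: s_def)
    qed
  qed
  moreover have "(\<lambda>f. restrict f D) ` ?B \<subseteq> D \<rightarrow>\<^sub>E A"
    using D(3) by (auto simp: PiE_def Pi_def)
  ultimately have "card ?B \<le> card (D \<rightarrow>\<^sub>E A)"
    by (intro card_inj_on_le) (auto intro!: finite_PiE D assms)
  also have "\<dots> = card A ^ card D" using D(1) by (simp add: card_PiE)
  also have "\<dots> \<le> card A ^ (p - M)" using D(2) False by (intro power_increasing) auto
  finally show ?thesis .
qed

text \<open>A union bound over starts and distances. Distances up to \<open>p div 2\<close> suffice,
  since one of the two arcs between two points of a cycle is that short, and
  \<open>M \<le> p - p div 2\<close> then gives \<open>M + d \<le> p\<close>.\<close>

lemma exists_distinct_blocks: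
  assumes "finite A" "card A > 0" "p > 0" "M \<le> p - p div 2" "p * (p div 2) < card A ^ M"
  obtains f where "f \<in> {..<p} \<rightarrow> A" "distinct_blocks (\<lambda>i. f (i mod p)) p M"
proof -
  define bad where "bad = (\<lambda>(i, d). {f \<in> {..<p} \<rightarrow>\<^sub>E A.
    \<forall>t<M. f ((i + t) mod p) = f ((i + d + t) mod p)})"
  let ?I = "{..<p} \<times> {1..p div 2}"
  have fin: "finite (\<Union>(bad ` ?I))"
    by (rule finite_subset[of _ "{..<p} \<rightarrow>\<^sub>E A"]) (auto simp: bad_def intro: finite_PiE assms(1))
  have "card (\<Union>(bad ` ?I)) \<le> (\<Sum>x\<in>?I. card (bad x))" by (rule card_UN_le) auto
  also have "\<dots> \<le> (\<Sum>x\<in>?I. card A ^ (p - M))"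
  proof (rule sum_mono, clarify)
    fix i d assume "d \<in> {1..p div 2}"
    then show "card (bad (i, d)) \<le> card A ^ (p - M)"
      unfolding bad_def prod.case by (intro card_repeated_block) (use assms in auto)
  qed
  also have "\<dots> = p * (p div 2) * card A ^ (p - M)" by simp
  also have "\<dots> < card A ^ M * card A ^ (p - M)"
    using assms by simp
  also have "\<dots> = card ({..<p} \<rightarrow>\<^sub>E A)"
    using assms by (simp add: card_PiE flip: power_add)
  finally have "\<not> {..<p} \<rightarrow>\<^sub>E A \<subseteq> \<Union>(bad ` ?I)"
    using fin by (meson card_mono leD)
  then obtain f where f: "f \<in> {..<p} \<rightarrow>\<^sub>E A" "f \<notin> \<Union>(bad ` ?I)" by blast
  have no_repeat: "\<not> (\<forall>t<M. f ((i + t) mod p) = f ((i + d + t) mod p))"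
    if "i < p" "1 \<le> d" "d \<le> p div 2" for i d
  proof -
    have "(i, d) \<in> ?I" using that by simp
    then have "f \<notin> bad (i, d)" using f(2) by (metis UN_I)
    then show ?thesis using f(1) by (simp add: bad_def)
  qed
  have aux: False if "a < b" "b < p" "\<forall>t<M. f ((a + t) mod p) = f ((b + t) mod p)" for a b
  proof (cases "b - a \<le> p div 2")
    case True
    then show False using no_repeat[of a "b - a"] that by (simp add: Suc_le_eq)
  next
    case False
    \<comment> \<open>The other arc is the short one: it leads from \<open>b\<close> around the end
      of the period to \<open>a\<close>.\<close>
    then have "p - (b - a) \<le> p div 2" by linarith
    moreover have "(b + (p - (b - a)) + t) mod p = (a + t) mod p" for t
    proof -
      have "b + (p - (b - a)) + t = a + t + p" using that by simp
      then show ?thesis by (metis mod_add_self2)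
    qed
    ultimately show False using no_repeat[of b "p - (b - a)"] that by (simp add: Suc_le_eq)
  qed
  have "distinct_blocks (\<lambda>i. f (i mod p)) p M"
    unfolding distinct_blocks_def
  proof (intro allI impI)
    fix i j assume *: "\<forall>t<M. f ((i + t) mod p) = f ((j + t) mod p)"
    then have "\<forall>t<M. f ((i mod p + t) mod p) = f ((j mod p + t) mod p)"
      by (simp add: mod_simps)
    then show "i mod p = j mod p"
      using aux[of "i mod p" "j mod p"] aux[of "j mod p" "i mod p"] \<open>p > 0\<close>
      by (metis linorder_neqE_nat mod_less_divisor)
  qed
  with f(1) that show thesis by (auto simp: PiE_def)
qed

text \<open>A window of length \<open>p\<close> contains exactly one multiple of \<open>p\<close>,
  so the place of its \<open>x\<close> determines the start modulo \<open>p\<close>.\<close>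

lemma distinct_blocks_marker:
  assumes "p > 0" "x \<noteq> y"
  shows "distinct_blocks (\<lambda>i. if i mod p = 0 then x else y) p p"
  unfolding distinct_blocks_def
proof (intro allI impI)
  fix i j
  assume *: "\<forall>t<p. (if (i + t) mod p = 0 then x else y) = (if (j + t) mod p = 0 then x else y)"
  define t where "t = (p - i mod p) mod p"
  have "(i + t) mod p = (i mod p + (p - i mod p)) mod p" by (simp add: t_def mod_simps)
  then have i: "(i + t) mod p = 0" using \<open>p > 0\<close> by (simp add: less_imp_le)
  have "t < p" using \<open>p > 0\<close> by (simp add: t_def)
  with * i assms(2) have "(j + t) mod p = 0" by metis
  with i have "(i + t) mod p = (j + t) mod p" by simp
  then show "i mod p = j mod p" by (simp add: cong_add_rcancel_nat flip: cong_def)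
qed

text \<open>The induction starts from 98 < 128; at \<open>q = 6\<close> the inequality fails, as 72
  > 64.\<close>

lemma two_square_less_power: "q \<ge> 7 \<Longrightarrow> 2 * q\<^sup>2 < (2::nat) ^ q"
proof (induction q rule: dec_induct)
  case (step q)
  have "2 * q + 1 \<le> q * q" using mult_le_mono1[of 7 q q] step by linarith
  then show ?case using step by (simp add: power2_eq_square)
qed simp

text \<open>For long periods \<open>M = 2 * L\<close> satisfies the count, as \<open>p * p\<close>
  is at most \<open>card A ^ (2 * L)\<close>. If this exceeds \<open>p - p div 2\<close>, that
  smaller value is taken instead and still suffices.\<close>

lemma exists_cyclic_word:
  assumes "finite A" "card A \<ge> 2" "p \<ge> 1" "p \<le> card A ^ L"
  obtains f M where "\<And>i. f i \<in> A" "\<And>i. f (i + p) = f i" "distinct_blocks f p M"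
    "M \<ge> 1" "M \<le> 2 * L + 4"
proof (cases "p \<le> 2 * L + 4")
  case True
  obtain x y where "x \<in> A" "y \<in> A" "x \<noteq> y"
    using assms(2) by (auto simp: card_le_Suc_iff numeral_2_eq_2)
  then show thesis
    using that[of "\<lambda>i. if i mod p = 0 then x else y" p] distinct_blocks_marker[of p x y] assms True
    by simp
next
  case False
  have "\<exists>M. M \<ge> 1 \<and> M \<le> 2 * L + 4 \<and> M \<le> p - p div 2 \<and> p * (p div 2) < card A ^ M"
  proof (cases "2 * L \<le> p - p div 2")
    case True
    have "p * (p div 2) < p * p" using assms(3) by simp
    also have "\<dots> \<le> card A ^ (2 * L)"
      using mult_le_mono[OF assms(4) assms(4)] by (simp add: mult_2 power_add)
    finally have "p * (p div 2) < card A ^ (2 * L)" .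
    moreover have "L \<ge> 1" using assms(4) False by (cases L) auto
    ultimately show ?thesis using True by (intro exI[of _ "2 * L"]) simp
  next
    case small: False
    define q where "q = p - p div 2"
    have q: "p \<le> 2 * q" "p div 2 \<le> q" unfolding q_def by linarith+
    have "q < 2 * L" "2 * L + 5 \<le> p" using small False unfolding q_def by linarith+
    \<comment> \<open>Size alone gives \<open>q >= 6\<close>. If \<open>q = 6\<close>, parity forces
      \<open>2 * L >= 8\<close>, hence \<open>p >= 13 > 2 * q\<close>, a contradiction.\<close>
    with q(1) have "q \<ge> 7" by presburger
    have "p * (p div 2) \<le> 2 * q\<^sup>2"
      using mult_le_mono[OF q] by (simp add: power2_eq_square)
    also have "\<dots> < 2 ^ q" using two_square_less_power[OF \<open>q \<ge> 7\<close>] .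
    also have "\<dots> \<le> card A ^ q" using assms(2) by (intro power_mono) auto
    finally show ?thesis using \<open>q \<ge> 7\<close> small by (intro exI[of _ q]) (auto simp: q_def)
  qed
  then obtain M where M: "M \<ge> 1" "M \<le> 2 * L + 4" "M \<le> p - p div 2" "p * (p div 2) < card A ^ M"
    by blast
  obtain f where "f \<in> {..<p} \<rightarrow> A" "distinct_blocks (\<lambda>i. f (i mod p)) p M"
    using exists_distinct_blocks[OF assms(1) _ _ M(3,4)] assms(2,3) by auto
  then show thesis using that[of "\<lambda>i. f (i mod p)" M] M assms(3) by (auto simp: Pi_iff)
qed

section \<open>The logarithmic term and the final estimate\<close>

lemma le_power_ceiling_log:
  assumes "k \<ge> 2" "n \<ge> 3"
  obtains L :: nat where "\<lceil>log (real k) (real n / 3)\<rceil> = int L" "n div 3 \<le> k ^ L"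
proof -
  have "log (real k) (real n / 3) \<ge> 0" using assms by simp
  then have "\<lceil>log (real k) (real n / 3)\<rceil> \<ge> 0" by linarith
  then obtain L where L: "\<lceil>log (real k) (real n / 3)\<rceil> = int L" by (metis nonneg_int_cases)
  then have "log (real k) (real n / 3) \<le> real L" by linarith
  then have "real n / 3 \<le> real k powr real L"
    using assms by (subst (asm) log_le_iff) auto
  also have "\<dots> = real (k ^ L)" using assms by (simp add: powr_realpow)
  finally have "real (n div 3) \<le> real (k ^ L)" by linarith
  with L that show thesis using of_nat_le_iff by blast
qed

text \<open>For \<open>n\<close> equal to 1 or 2 the logarithm is negative and raises the claimed
  bound; a ceiling of at least -1 or 0, respectively, keeps that bound nonpositive.\<close>

lemma ceiling_log_small:
  assumes "k \<ge> 2" "n = 1 \<or> n = 2"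
  shows "\<lceil>log (real k) (real n / 3)\<rceil> \<ge> int n - 2"
proof -
  have "real k powr (real n - 3) \<le> 2 powr (real n - 3)"
    using assms by (intro powr_mono2') auto
  also have "\<dots> < real n / 3"
    using assms(2) by (auto simp: powr_minus powr_numeral)
  finally have "real n - 3 < log (real k) (real n / 3)"
    using assms by (subst less_log_iff) auto
  then show ?thesis by linarith
qed

theorem proposition8:
  fixes A :: "'a set" and n :: nat
  assumes "finite A" and "card A \<ge> 2" and "n \<ge> 1"
  shows "\<exists>w. w \<in> lists A \<and> length w = n \<and>
    real (card (closed_factors w)) \<ge>
      (real n)\<^sup>2 / 6
      - 2 * real n / 3 * real_of_int \<lceil>log (real (card A)) (real n / 3)\<rceil>
      - 5 * real n / 6"
proof (cases "n \<ge> 3")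
  case True
  \<comment> \<open>The leading term \<open>p * (2 * n - 3 * p)\<close> of twice the count is
    largest at \<open>p = n / 3\<close>.\<close>
  define p r where "p = n div 3" and "r = n mod 3"
  have n: "n = 3 * p + r" and r: "r \<le> 2" and p: "p \<ge> 1"
    using True by (auto simp: p_def r_def)
  obtain L where L: "\<lceil>log (real (card A)) (real n / 3)\<rceil> = int L" "p \<le> card A ^ L"
    using le_power_ceiling_log[OF assms(2) True] unfolding p_def by metis
  obtain f M where f: "\<And>i. f i \<in> A" "\<And>i. f (i + p) = f i" "distinct_blocks f p M"
    and M: "M \<ge> 1" "M \<le> 2 * L + 4"
    using exists_cyclic_word[OF assms(1,2) p L(2)] by metis
  let ?w = "map f [0..<n]"
  let ?B = "(real n)\<^sup>2 / 6 - 2 * real n / 3 * real L - 5 * real n / 6"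
  \<comment> \<open>With the largest allowed \<open>M = 2 * L + 4\<close>, twice the counting bound
    is \<open>2 * ?B\<close> plus a nonnegative term from the remainder \<open>r\<close>; for
    \<open>r = 0\<close> the two agree exactly.\<close>
  have "2 * ?B + real r * (4 * real L + (5 - real r)) / 3 =
      real p * (2 * (real n + 1 - (2 * real L + 4)) - 3 * real p + 1)"
    by (simp add: n power2_eq_square field_simps)
  moreover have "0 \<le> real r * (4 * real L + (5 - real r)) / 3" using r by simp
  ultimately have "2 * ?B \<le> real p * (2 * (real n + 1 - (2 * real L + 4)) - 3 * real p + 1)"
    by (metis le_add_same_cancel1)
  also have "\<dots> \<le> real p * (2 * (real n + 1 - real M) - 3 * real p + 1)"
    using M(2) by (intro mult_left_mono) auto
  also have "\<dots> \<le> 2 * real (\<Sum>l\<in>{p + M..n}. min p (n + 1 - l))"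
    using sum_min_interval_ge[of p n M] n by simp
  also have "\<dots> \<le> 2 * real (card (closed_factors ?w))"
    using card_closed_factors_periodic[OF f(2,3) p M(1), of n] by linarith
  finally have "real (card (closed_factors ?w)) \<ge> ?B"
    by (simp only: mult_le_cancel_left_pos zero_less_numeral)
  then show ?thesis using f(1) L(1) by (intro exI[of _ ?w]) auto
next
  case False
  then have n: "n = 1 \<or> n = 2" using assms(3) by auto
  obtain x where x: "x \<in> A" using assms(2) by fastforce
  have "(real n)\<^sup>2 / 6 - 2 * real n / 3 * real_of_int c - 5 * real n / 6 \<le> 0"
    if "c \<ge> int n - 2" for c
    using n that by auto
  note this[OF ceiling_log_small[OF assms(2) n]]
  also have "0 \<le> real (card (closed_factors (replicate n x)))" by simp
  finally show ?thesis using x by (intro exI[of _ "replicate n x"]) auto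
qed

end
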